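(* There exist positive definite matrices $A,B,C\in\mathbb{M}_2(\mathbb{C})_{++}$ such that $$d_{1/2}(A,B)>d_{1/2}(A,C)+d_{1/2}(C,B).$$
   Context: $\mathbb{M}_2(\mathbb{C})_{++}$ is the cone of positive definite $2\times2$ complex matrices. For $p>0$ and $X,Y\in\mathbb{M}_2(\mathbb{C})_{++}$, define $$d_p(X,Y):=\Bigl(\operatorname{Tr}\Bigl(\frac{X+Y}{2}-\bigl(X^{p/4}Y^{p/2}X^{p/4}\bigr)^{1/p}\Bigr)\Bigr)^{1/2},$$ where $\operatorname{Tr}$ is the usual matrix trace and real powers of positive definite matrices are defined by functional calculus; the trace under the outer square root is nonnegative for every $p>0$, so $d_p$ is well defined. In particular, for $p=\tfrac12$, $d_{1/2}(X,Y)=\Bigl(\operatorname{Tr}\Bigl(\frac{X+Y}{2}-\bigl(X^{1/8}Y^{1/4}X^{1/8}\bigr)^{2}\Bigr)\Bigr)^{1/2}$. *)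

theory Defs
  imports "HOL-Analysis.Analysis"
begin

definition conj_transpose :: "complex^'n^'m \<Rightarrow> complex^'m^'n" where
  "conj_transpose A = map_matrix cnj (transpose A)"

definition hermitian :: "complex^'n^'n \<Rightarrow> bool" where
  "hermitian A \<longleftrightarrow> conj_transpose A = A"

definition unitary :: "complex^'n^'n \<Rightarrow> bool" where
  "unitary U \<longleftrightarrow> conj_transpose U ** U = mat 1 \<and> U ** conj_transpose U = mat 1"

text \<open>For Hermitian \<open>A\<close> the form below is real-valued, so taking the real part loses nothing.\<close>

definition pos_def :: "complex^'n^'n \<Rightarrow> bool" where
  "pos_def A \<longleftrightarrow> hermitian A \<and>
     (\<forall>x. x \<noteq> 0 \<longrightarrow> 0 < Re (\<Sum>i\<in>UNIV. cnj (x $ i) * (A *v x) $ i))"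

definition real_diag :: "('n \<Rightarrow> real) \<Rightarrow> complex^'n^'n" where
  "real_diag d = (\<chi> i j. if i = j then complex_of_real (d i) else 0)"

text \<open>
  Functional calculus: if \<open>A = U D U\<^sup>*\<close> with \<open>U\<close> unitary and \<open>D\<close> real diagonal, then
  \<open>f(A) = U f(D) U\<^sup>*\<close>. The result does not depend on the diagonalization chosen
  (lemma \<open>fun_calc_eqI\<close>), and one exists exactly when \<open>A\<close> is Hermitian; for other \<open>A\<close> the
  value is unspecified.
\<close>

definition fun_calc :: "(real \<Rightarrow> real) \<Rightarrow> complex^'n^'n \<Rightarrow> complex^'n^'n" where
  "fun_calc f A = (THE B. \<exists>U d. unitary U \<and>
     A = U ** real_diag d ** conj_transpose U \<and>
     B = U ** real_diag (\<lambda>i. f (d i)) ** conj_transpose U)"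

definition mat_powr :: "complex^'n^'n \<Rightarrow> real \<Rightarrow> complex^'n^'n" (infixr \<open>mpowr\<close> 80) where
  "A mpowr r = fun_calc (\<lambda>t. t powr r) A"

text \<open>The trace below is real for positive definite \<open>X\<close> and \<open>Y\<close>; \<open>Re\<close> is only a change of type.\<close>

definition d_p :: "real \<Rightarrow> complex^'n^'n \<Rightarrow> complex^'n^'n \<Rightarrow> real" where
  "d_p p X Y = sqrt (Re (trace ((1/2) *\<^sub>R (X + Y) -
     (X mpowr (p/4) ** Y mpowr (p/2) ** X mpowr (p/4)) mpowr (1/p))))"

lemma fun_calc_unique:
  fixes U V :: "complex^'n^'n"
  assumes U: "unitary U" and V: "unitary V"
    and eq: "U ** real_diag d ** conj_transpose U = V ** real_diag e ** conj_transpose V"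
  shows "U ** real_diag (\<lambda>i. f (d i)) ** conj_transpose U =
         V ** real_diag (\<lambda>i. f (e i)) ** conj_transpose V"
proof -
  define W where "W = conj_transpose V ** U"
  have U1: "conj_transpose U ** U = mat 1" and U2: "U ** conj_transpose U = mat 1"
    and V1: "conj_transpose V ** V = mat 1" and V2: "V ** conj_transpose V = mat 1"
    using U V by (auto simp: unitary_def)
  have "conj_transpose V ** (U ** real_diag d ** conj_transpose U) ** U =
        conj_transpose V ** (V ** real_diag e ** conj_transpose V) ** U"
    by (simp only: eq)
  hence "W ** real_diag d ** (conj_transpose U ** U) =
         (conj_transpose V ** V) ** real_diag e ** W"
    by (simp add: W_def matrix_mul_assoc)
  hence comm: "W ** real_diag d = real_diag e ** W"
    by (simp add: U1 V1)
  have R: "(W ** real_diag g) $ i $ j = W $ i $ j * complex_of_real (g j)" for g i j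
    by (simp add: matrix_matrix_mult_def real_diag_def if_distrib cong: if_cong)
  have L: "(real_diag g ** W) $ i $ j = complex_of_real (g i) * W $ i $ j" for g i j
    by (simp add: matrix_matrix_mult_def real_diag_def if_distribR if_distrib cong: if_cong)
  have "W ** real_diag (\<lambda>i. f (d i)) = real_diag (\<lambda>i. f (e i)) ** W"
  proof -
    have alt: "W $ i $ j = 0 \<or> d j = e i" for i j
    proof -
      have "W $ i $ j * complex_of_real (d j) = complex_of_real (e i) * W $ i $ j"
        by (metis comm R L)
      hence "W $ i $ j * complex_of_real (d j - e i) = 0"
        by (simp add: algebra_simps)
      hence "W $ i $ j = 0 \<or> d j - e i = 0"
        by (simp only: mult_eq_0_iff of_real_eq_0_iff)
      thus ?thesis by simp
    qed
    have "W $ i $ j * complex_of_real (f (d j)) = complex_of_real (f (e i)) * W $ i $ j" for i j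
      using alt[of i j] by (elim disjE) simp_all
    thus ?thesis by (simp add: vec_eq_iff R L)
  qed
  hence "V ** (W ** real_diag (\<lambda>i. f (d i))) ** conj_transpose U =
         V ** (real_diag (\<lambda>i. f (e i)) ** W) ** conj_transpose U" by simp
  hence "(V ** conj_transpose V) ** U ** real_diag (\<lambda>i. f (d i)) ** conj_transpose U =
         V ** real_diag (\<lambda>i. f (e i)) ** conj_transpose V ** (U ** conj_transpose U)"
    by (simp add: W_def matrix_mul_assoc)
  thus ?thesis by (simp add: U2 V2)
qed

lemma fun_calc_eqI:
  assumes "unitary U" and "A = U ** real_diag d ** conj_transpose U"
  shows "fun_calc f A = U ** real_diag (\<lambda>i. f (d i)) ** conj_transpose U"
  unfolding fun_calc_def
proof (rule the_equality)
  show "\<exists>V e. unitary V \<and> A = V ** real_diag e ** conj_transpose V \<and>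
      U ** real_diag (\<lambda>i. f (d i)) ** conj_transpose U =
      V ** real_diag (\<lambda>i. f (e i)) ** conj_transpose V"
    using assms by blast
next
  fix B
  assume "\<exists>V e. unitary V \<and> A = V ** real_diag e ** conj_transpose V \<and>
      B = V ** real_diag (\<lambda>i. f (e i)) ** conj_transpose V"
  then obtain V e where V: "unitary V" "A = V ** real_diag e ** conj_transpose V"
    "B = V ** real_diag (\<lambda>i. f (e i)) ** conj_transpose V" by blast
  show "B = U ** real_diag (\<lambda>i. f (d i)) ** conj_transpose U"
    using fun_calc_unique[OF V(1) assms(1), of e d f] V assms(2) by simp
qed

end

theory Submission
  imports Defs
begin

text \<open>
  Write \<open>X = R\<^sup>4\<close> and \<open>Y = S\<^sup>4\<close> with \<open>R\<close>, \<open>S\<close> positive definite. Every power occurring in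
  \<open>d\<^sub>p\<close> for \<open>p = 1/2\<close> then disappears, and (\<open>d_half_fourth_powers\<close>) the squared distance is
  \<open>Tr ((R\<^sup>4 + S\<^sup>4)/2 - RSRS)\<close>. In terms of the Hilbert-Schmidt norm this equals
  \<open>|R\<^sup>2 - S\<^sup>2|\<^sup>2 / 2 + |RS - SR|\<^sup>2 / 2\<close>: the squared distance between the squares, plus a penalty
  for not commuting. The penalty is what breaks the triangle inequality, because an intermediate
  point can be chosen closer to the scalar matrices, where commutators are smaller.

  In detail, let \<open>R\<close> and \<open>S\<close> have diagonal \<open>(a, c)\<close> with \<open>a > c\<close> and off-diagonal entries
  \<open>b\<close> and \<open>- b\<close>, where \<open>b \<noteq> 0\<close>. Conjugation by \<open>diag (1, -1)\<close> exchanges them, so a diagonal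
  \<open>T = diag (a', c')\<close> has the same distance \<open>e\<close> to both (distances being understood between the
  fourth powers), and the triangle inequality fails as soon as the distance \<open>f\<close> of \<open>R\<close> and \<open>S\<close>
  satisfies \<open>f\<^sup>2 > 4 e\<^sup>2\<close>. The entries of the matrices (\<open>d_half_sym2\<close>) give
  \<open>f\<^sup>2 - 4 e\<^sup>2 = 4 b\<^sup>2 ((a - c)\<^sup>2 - (a' - c')\<^sup>2) - 2 ((a\<^sup>2 + b\<^sup>2 - a'\<^sup>2)\<^sup>2 + (b\<^sup>2 + c\<^sup>2 - c'\<^sup>2)\<^sup>2)\<close>.
  If \<open>T\<^sup>2\<close> is the mean of \<open>R\<^sup>2\<close> and \<open>S\<^sup>2\<close>, the subtracted term vanishes, and
  \<open>a' - c' = (a\<^sup>2 - c\<^sup>2) / (a' + c') < a - c\<close> makes the first term positive. For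
  \<open>(a, b, c) = (4, 1, 1)\<close> this \<open>T\<close> is \<open>diag (sqrt 17, sqrt 2)\<close>; the nearby \<open>diag (4, 2)\<close> keeps all
  entries integral and still leaves \<open>f\<^sup>2 - 4 e\<^sup>2 = 136 - 126 = 10\<close>.

  The remaining work is to justify the calculus of real powers on positive definite \<open>2 \<times> 2\<close>
  matrices. It rests on the spectral theorem \<open>hermitian_2x2_diagonalizable\<close>, which is needed
  because \<open>X\<^bsup>1/8\<^esup> Y\<^bsup>1/4\<^esup> X\<^bsup>1/8\<^esup>\<close> must be diagonalized before it can be squared by
  functional calculus.
\<close>

section \<open>Adjoints, positive definiteness and congruence\<close>

lemma conj_transpose_component [simp]: "conj_transpose A $ i $ j = cnj (A $ j $ i)"
  by (simp add: conj_transpose_def map_matrix_def transpose_def)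

lemma conj_transpose_mult: "conj_transpose (A ** B) = conj_transpose B ** conj_transpose A"
  by (simp add: vec_eq_iff matrix_matrix_mult_def mult.commute)

lemma conj_transpose_conj_transpose [simp]: "conj_transpose (conj_transpose A) = A"
  by (simp add: vec_eq_iff)

lemma conj_transpose_real_diag [simp]: "conj_transpose (real_diag d) = real_diag d"
  by (simp add: vec_eq_iff real_diag_def)

lemma real_diag_mult_left: "(real_diag d ** A) $ i $ j = complex_of_real (d i) * A $ i $ j"
proof -
  have "(real_diag d ** A) $ i $ j = (\<Sum>k\<in>UNIV. if i = k then complex_of_real (d i) * A $ k $ j else 0)"
    unfolding matrix_matrix_mult_def real_diag_def by (simp only: vec_lambda_beta) (rule sum.cong, auto)
  thus ?thesis by simp
qed

lemma real_diag_mult: "real_diag d ** real_diag e = real_diag (\<lambda>i. d i * e i)"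
  unfolding vec_eq_iff real_diag_mult_left by (simp add: real_diag_def)

lemma real_diag_mult_vec: "(real_diag d *v x) $ i = complex_of_real (d i) * x $ i"
proof -
  have "(real_diag d *v x) $ i = (\<Sum>k\<in>UNIV. if i = k then complex_of_real (d i) * x $ k else 0)"
    unfolding matrix_vector_mult_def real_diag_def by (simp only: vec_lambda_beta) (rule sum.cong, auto)
  thus ?thesis by simp
qed

lemma quadratic_form_congruence:
  fixes A :: "complex^'n^'n"
  shows "(\<Sum>i\<in>UNIV. cnj (x $ i) * ((conj_transpose B ** A ** B) *v x) $ i) =
         (\<Sum>i\<in>UNIV. cnj ((B *v x) $ i) * (A *v (B *v x)) $ i)"
proof -
  have adj: "(\<Sum>i\<in>UNIV. cnj (x $ i) * (conj_transpose B *v y) $ i) =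
             (\<Sum>j\<in>UNIV. cnj ((B *v x) $ j) * y $ j)" for y :: "complex^'n"
    unfolding matrix_vector_mult_def
    by (simp add: sum_distrib_left sum_distrib_right mult_ac) (rule sum.swap)
  show ?thesis
    using adj[of "A *v (B *v x)"] by (simp add: matrix_vector_mul_assoc matrix_mul_assoc)
qed

lemma pos_def_congruence:
  fixes A :: "complex^'n^'n"
  assumes "pos_def A" and inj: "\<And>x. B *v x = 0 \<Longrightarrow> x = 0"
  shows "pos_def (conj_transpose B ** A ** B)"
  using assms unfolding pos_def_def quadratic_form_congruence hermitian_def
  by (auto simp: conj_transpose_mult matrix_mul_assoc)

lemma pos_def_kernel_trivial: "pos_def A \<Longrightarrow> A *v x = 0 \<Longrightarrow> x = 0"
  unfolding pos_def_def by fastforce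

lemma pos_def_real_diag_iff:
  fixes d :: "'a::finite \<Rightarrow> real"
  shows "pos_def (real_diag d) \<longleftrightarrow> (\<forall>i. 0 < d i)"
proof
  assume "pos_def (real_diag d)"
  hence *: "0 < Re (\<Sum>j\<in>UNIV. cnj (x $ j) * (real_diag d *v x) $ j)" if "x \<noteq> 0" for x
    using that by (auto simp: pos_def_def)
  show "\<forall>i. 0 < d i"
  proof
    fix i :: 'a
    have "axis i 1 \<noteq> (0 :: complex^'a)" by (simp add: axis_eq_0_iff)
    from *[OF this] show "0 < d i"
      by (simp add: real_diag_mult_vec axis_def if_distrib cong: if_cong)
  qed
next
  assume d: "\<forall>i. 0 < d i"
  have "0 < Re (\<Sum>j\<in>UNIV. cnj (x $ j) * (real_diag d *v x) $ j)" if x: "x \<noteq> 0" for x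
  proof -
    obtain k where k: "x $ k \<noteq> 0" using x by (auto simp: vec_eq_iff)
    have "Re (\<Sum>j\<in>UNIV. cnj (x $ j) * (real_diag d *v x) $ j) = (\<Sum>j\<in>UNIV. d j * (cmod (x $ j))\<^sup>2)"
      by (simp add: real_diag_mult_vec cmod_power2)
        (intro sum.cong refl, simp add: algebra_simps power2_eq_square)
    also have "\<dots> > 0"
    proof (rule sum_pos2[of _ k])
      show "0 < d k * (cmod (x $ k))\<^sup>2" using d k by simp
      show "0 \<le> d j * (cmod (x $ j))\<^sup>2" for j using d[rule_format, of j] by simp
    qed auto
    finally show ?thesis .
  qed
  thus "pos_def (real_diag d)" by (auto simp: pos_def_def hermitian_def)
qed

lemma unitary_kernel_trivial:
  assumes "unitary U" "U *v x = 0" shows "x = 0"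
proof -
  have "x = (conj_transpose U ** U) *v x" using assms(1) by (simp add: unitary_def)
  also have "\<dots> = 0" using assms(2) by (simp flip: matrix_vector_mul_assoc)
  finally show ?thesis .
qed

lemma unitary_conj_transpose: "unitary U \<Longrightarrow> unitary (conj_transpose U)"
  by (simp add: unitary_def)

text \<open>
  The two matrices are congruent to each other, by \<open>U\<close> in one direction and by its adjoint in the
  other, so one is positive definite as soon as the other is.
\<close>

lemma pos_def_diagonalized_iff:
  fixes U :: "complex^'n^'n"
  assumes U: "unitary U"
  shows "pos_def (U ** real_diag d ** conj_transpose U) \<longleftrightarrow> (\<forall>i. 0 < d i)"
proof -
  let ?A = "U ** real_diag d ** conj_transpose U"
  have "conj_transpose U ** ?A ** U =
        (conj_transpose U ** U) ** real_diag d ** (conj_transpose U ** U)"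
    by (simp only: matrix_mul_assoc)
  hence "conj_transpose U ** ?A ** U = real_diag d"
    using U by (simp add: unitary_def)
  hence "pos_def ?A \<Longrightarrow> pos_def (real_diag d)"
    using pos_def_congruence[of ?A U] unitary_kernel_trivial[OF U] by simp
  moreover have "pos_def (real_diag d) \<Longrightarrow> pos_def ?A"
    using pos_def_congruence[of "real_diag d" "conj_transpose U"]
      unitary_kernel_trivial[OF unitary_conj_transpose[OF U]] by simp
  ultimately show ?thesis unfolding pos_def_real_diag_iff by blast
qed

section \<open>The spectral theorem in dimension two\<close>

text \<open>
  In dimension two the eigenvalues are the roots of a real quadratic polynomial, and a vector
  orthogonal to an eigenvector is again an eigenvector, so both can be written down. The formula
  for the eigenvectors degenerates when \<open>A\<close> is already diagonal, which is why that case is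
  separate.
\<close>

lemma hermitian_2x2_diagonalizable:
  fixes A :: "complex^2^2"
  assumes "hermitian A"
  obtains U d where "unitary U" "A = U ** real_diag d ** conj_transpose U"
proof -
  have sym: "cnj (A $ j $ i) = A $ i $ j" for i j
    using assms unfolding hermitian_def by (metis conj_transpose_component)
  obtain a where a: "A $ 1 $ 1 = complex_of_real a"
    using sym[of 1 1] by (metis Reals_cnj_iff Reals_cases)
  obtain c where c: "A $ 2 $ 2 = complex_of_real c"
    using sym[of 2 2] by (metis Reals_cnj_iff Reals_cases)
  define b where "b = A $ 1 $ 2"
  have b': "A $ 2 $ 1 = cnj b" using sym[of 1 2] by (simp add: b_def)
  show ?thesis
  proof (cases "b = 0")
    case True
    have "A = mat 1 ** real_diag (\<lambda>i. if i = 1 then a else c) ** conj_transpose (mat 1)"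
      using True a b' c b_def
      by (auto simp: vec_eq_iff forall_2 real_diag_def matrix_matrix_mult_def sum_2 mat_def)
    moreover have "unitary (mat 1 :: complex^2^2)"
      by (auto simp: unitary_def vec_eq_iff forall_2 matrix_matrix_mult_def sum_2 mat_def)
    ultimately show ?thesis using that by blast
  next
    case False
    \<comment> \<open>\<open>(b, k)\<close> is an eigenvector for the eigenvalue \<open>a + k\<close> exactly when \<open>k\<close> solves this
      quadratic equation, and \<open>(- k, cnj b)\<close> is then one for \<open>c - k\<close>.\<close>
    obtain k where k: "k\<^sup>2 + (a - c) * k = (cmod b)\<^sup>2"
    proof
      let ?D = "(a - c)\<^sup>2 + 4 * (cmod b)\<^sup>2"
      have "(sqrt ?D)\<^sup>2 = ?D" by simp
      thus "((c - a + sqrt ?D) / 2)\<^sup>2 + (a - c) * ((c - a + sqrt ?D) / 2) = (cmod b)\<^sup>2"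
        by (simp add: power2_eq_square field_simps)
    qed
    define s where "s = sqrt ((cmod b)\<^sup>2 + k\<^sup>2)"
    have "0 < (cmod b)\<^sup>2 + k\<^sup>2" using False by (simp add: add_pos_nonneg)
    hence s: "s \<noteq> 0" "s\<^sup>2 = (cmod b)\<^sup>2 + k\<^sup>2" by (auto simp: s_def)
    have bb: "b * cnj b = complex_of_real ((cmod b)\<^sup>2)"
      using complex_norm_square[of b] by simp
    have ss: "b * cnj b + complex_of_real k * complex_of_real k = complex_of_real s * complex_of_real s"
      unfolding bb using s(2) by (simp add: power2_eq_square flip: of_real_mult of_real_add)
    have kk: "complex_of_real k * complex_of_real k + (complex_of_real a - complex_of_real c) * complex_of_real k
                = b * cnj b"
      unfolding bb using k by (simp add: power2_eq_square flip: of_real_mult of_real_add of_real_diff)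
    define U :: "complex^2^2" where
      "U = (\<chi> i j. (if j = 1 then (if i = 1 then b else k) else (if i = 1 then - k else cnj b)) / s)"
    define d :: "2 \<Rightarrow> real" where "d = (\<lambda>j. if j = 1 then a + k else c - k)"
    have U: "unitary U"
      using s(1) ss unfolding unitary_def
      by (auto simp: U_def vec_eq_iff forall_2 matrix_matrix_mult_def sum_2 mat_def divide_simps)
         (simp_all add: algebra_simps)
    have "A ** U = U ** real_diag d"
      using s(1) kk
      by (auto simp: U_def d_def real_diag_def vec_eq_iff forall_2 matrix_matrix_mult_def sum_2
          a b' c divide_simps simp flip: b_def)
         (simp_all add: algebra_simps)
    hence "A ** U ** conj_transpose U = U ** real_diag d ** conj_transpose U" by simp
    hence "A = U ** real_diag d ** conj_transpose U"
      using U by (simp add: unitary_def flip: matrix_mul_assoc)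
    with U show ?thesis using that by blast
  qed
qed

lemma pos_def_2x2_diagonalizable:
  fixes A :: "complex^2^2"
  assumes "pos_def A"
  obtains U d where "unitary U" "\<And>i. 0 < d i" "A = U ** real_diag d ** conj_transpose U"
proof -
  have "hermitian A" using assms by (simp add: pos_def_def)
  then obtain U d where U: "unitary U" and A: "A = U ** real_diag d ** conj_transpose U"
    by (rule hermitian_2x2_diagonalizable)
  have "\<forall>i. 0 < d i" using assms unfolding A pos_def_diagonalized_iff[OF U] .
  with U A show ?thesis using that by blast
qed

section \<open>Laws of real powers\<close>

text \<open>
  All powers of \<open>A\<close> are diagonal in one eigenbasis of \<open>A\<close>, so each law is the corresponding law for
  positive real numbers, applied to the eigenvalues.
\<close>

lemma mpowr_diagonalized:
  assumes "unitary U"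
  shows "(U ** real_diag d ** conj_transpose U) mpowr r =
         U ** real_diag (\<lambda>i. d i powr r) ** conj_transpose U"
  unfolding mat_powr_def using assms by (rule fun_calc_eqI) simp

lemma pos_def_mpowr:
  fixes A :: "complex^2^2"
  assumes "pos_def A"
  shows "pos_def (A mpowr r)"
proof -
  obtain U d where U: "unitary U" and d: "\<And>i. 0 < d i"
    and A: "A = U ** real_diag d ** conj_transpose U"
    using assms by (rule pos_def_2x2_diagonalizable) blast
  show ?thesis unfolding A mpowr_diagonalized[OF U] pos_def_diagonalized_iff[OF U]
    using d by (simp add: less_imp_neq[symmetric])
qed

lemma mpowr_one:
  fixes A :: "complex^2^2"
  assumes "pos_def A"
  shows "A mpowr 1 = A"
proof -
  obtain U d where U: "unitary U" and d: "\<And>i. 0 < d i"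
    and A: "A = U ** real_diag d ** conj_transpose U"
    using assms by (rule pos_def_2x2_diagonalizable) blast
  show ?thesis unfolding A mpowr_diagonalized[OF U]
    using d by (simp add: less_imp_le)
qed

lemma mpowr_mpowr:
  fixes A :: "complex^2^2"
  assumes "pos_def A"
  shows "(A mpowr r) mpowr s = A mpowr (r * s)"
proof -
  obtain U d where U: "unitary U" and d: "\<And>i. 0 < d i"
    and A: "A = U ** real_diag d ** conj_transpose U"
    using assms by (rule pos_def_2x2_diagonalizable) blast
  show ?thesis unfolding A mpowr_diagonalized[OF U] by (simp add: powr_powr)
qed

lemma mpowr_add:
  fixes A :: "complex^2^2"
  assumes "pos_def A"
  shows "A mpowr (r + s) = A mpowr r ** A mpowr s"
proof -
  obtain U d where U: "unitary U" and d: "\<And>i. 0 < d i"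
    and A: "A = U ** real_diag d ** conj_transpose U"
    using assms by (rule pos_def_2x2_diagonalizable) blast
  let ?D = "\<lambda>t. real_diag (\<lambda>i. d i powr t)"
  have "A mpowr r ** A mpowr s =
        U ** ?D r ** (conj_transpose U ** U) ** ?D s ** conj_transpose U"
    unfolding A mpowr_diagonalized[OF U] by (simp only: matrix_mul_assoc)
  also have "\<dots> = U ** (?D r ** ?D s) ** conj_transpose U"
    using U by (simp add: unitary_def matrix_mul_assoc)
  also have "\<dots> = A mpowr (r + s)"
    unfolding A mpowr_diagonalized[OF U] real_diag_mult by (simp add: powr_add)
  finally show ?thesis ..
qed

lemma mpowr_two:
  fixes A :: "complex^2^2"
  assumes "pos_def A"
  shows "A mpowr 2 = A ** A"
proof -
  have "A mpowr (1 + 1) = A ** A"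
    unfolding mpowr_add[OF assms] mpowr_one[OF assms] ..
  thus ?thesis by simp
qed

section \<open>The distance in terms of fourth roots\<close>

text \<open>
  With \<open>P = R\<^bsup>1/2\<^esup>\<close> the triple product in \<open>d\<^sub>p\<close> is \<open>P S P\<close>, which is congruent to \<open>S\<close>
  and hence positive definite; its power with exponent 2 is therefore the ordinary square. Under the
  trace the outer factors \<open>P\<close> can be moved cyclically until they meet and combine to \<open>R\<close>, so that no
  square root survives.
\<close>

lemma d_half_fourth_powers:
  fixes R S :: "complex^2^2"
  assumes R: "pos_def R" and S: "pos_def S"
  shows "d_p (1/2) (R mpowr 4) (S mpowr 4) =
    sqrt (Re (trace ((1/2) *\<^sub>R (R ** R ** (R ** R) + S ** S ** (S ** S)) - R ** S ** (R ** S))))"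
proof -
  define P where "P = R mpowr (1/2)"
  have P: "pos_def P" unfolding P_def by (rule pos_def_mpowr[OF R])
  hence Ph: "conj_transpose P = P" by (simp add: pos_def_def hermitian_def)
  have PP: "P ** P = R"
    unfolding P_def using mpowr_add[OF R, of "1/2" "1/2"] mpowr_one[OF R] by simp
  have M: "pos_def (P ** S ** P)"
    using pos_def_congruence[OF S, of P] pos_def_kernel_trivial[OF P] by (simp add: Ph)
  have four: "A mpowr 4 = A ** A ** (A ** A)" if "pos_def A" for A :: "complex^2^2"
    using mpowr_add[OF that, of 2 2] by (simp add: mpowr_two[OF that])
  have roots: "(R mpowr 4) mpowr (1/8) = P" "(S mpowr 4) mpowr (1/4) = S"
    by (simp_all add: mpowr_mpowr R S mpowr_one P_def)
  have "trace ((P ** S ** P) mpowr 2) = trace (P ** (S ** P ** P ** S ** P))"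
    by (simp add: mpowr_two[OF M] matrix_mul_assoc)
  also have "\<dots> = trace (S ** (P ** P) ** S ** (P ** P))"
    by (subst trace_mul_sym) (simp add: matrix_mul_assoc)
  also have "\<dots> = trace (R ** S ** (R ** S))"
    unfolding PP by (subst trace_mul_sym) (simp add: matrix_mul_assoc)
  finally have tr: "trace ((P ** S ** P) mpowr 2) = trace (R ** S ** (R ** S))" .
  show ?thesis
    unfolding d_p_def by (simp add: roots trace_sub tr) (simp add: four R S)
qed

section \<open>The counterexample\<close>

definition sym2 :: "real \<Rightarrow> real \<Rightarrow> real \<Rightarrow> complex^2^2" where
  "sym2 a b c = (\<chi> i j. complex_of_real (if i \<noteq> j then b else if i = 1 then a else c))"

text \<open>
  Completing the square: \<open>a\<close> times the quadratic form is
  \<open>|a x\<^sub>1 + b x\<^sub>2|\<^sup>2 + (a c - b\<^sup>2) |x\<^sub>2|\<^sup>2\<close>.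
\<close>

lemma pos_def_sym2:
  assumes a: "0 < a" and det: "b\<^sup>2 < a * c"
  shows "pos_def (sym2 a b c)"
  unfolding pos_def_def
proof (intro conjI allI impI)
  show "hermitian (sym2 a b c)" by (auto simp: hermitian_def sym2_def vec_eq_iff)
next
  fix x :: "complex^2" assume x: "x \<noteq> 0"
  let ?q = "Re (\<Sum>i\<in>UNIV. cnj (x $ i) * (sym2 a b c *v x) $ i)"
  have q: "a * ?q = (cmod (a * x $ 1 + b * x $ 2))\<^sup>2 + (a * c - b\<^sup>2) * (cmod (x $ 2))\<^sup>2"
    unfolding cmod_power2
    by (simp add: sym2_def matrix_vector_mult_def sum_2) (simp add: algebra_simps power2_eq_square)
  have "0 < a * ?q"
  proof (cases "x $ 2 = 0")
    case True
    hence "x $ 1 \<noteq> 0" using x by (auto simp: vec_eq_iff forall_2)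
    thus ?thesis unfolding q using True a by simp
  next
    case False
    thus ?thesis unfolding q using det by (simp add: add_nonneg_pos)
  qed
  thus "0 < ?q" using a by (simp add: zero_less_mult_iff)
qed

text \<open>
  The radicand is arranged as the half squared norm of the difference of the squares, whose entries
  are the three bases in the fraction, followed by the half squared norm of the commutator, which
  is skew-symmetric with the last base as its off-diagonal entry.
\<close>

lemma d_half_sym2:
  assumes "0 < a" "b\<^sup>2 < a * c" "0 < a'" "b'\<^sup>2 < a' * c'"
  shows "d_p (1/2) (sym2 a b c mpowr 4) (sym2 a' b' c' mpowr 4) =
    sqrt (((a\<^sup>2 + b\<^sup>2 - a'\<^sup>2 - b'\<^sup>2)\<^sup>2 + 2 * ((a + c) * b - (a' + c') * b')\<^sup>2
           + (b\<^sup>2 + c\<^sup>2 - b'\<^sup>2 - c'\<^sup>2)\<^sup>2) / 2 + ((a - c) * b' - (a' - c') * b)\<^sup>2)"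
  unfolding d_half_fourth_powers[OF pos_def_sym2[OF assms(1,2)] pos_def_sym2[OF assms(3,4)]]
  by (rule arg_cong[where f = sqrt])
     (simp add: trace_def sym2_def matrix_matrix_mult_def sum_2, simp add: field_simps power2_eq_square)

theorem proposition4p2:
  shows "\<exists>A B C :: complex^2^2. pos_def A \<and> pos_def B \<and> pos_def C \<and>
    d_p (1/2) A B > d_p (1/2) A C + d_p (1/2) C B"
proof -
  let ?A = "sym2 4 1 1 mpowr 4" and ?B = "sym2 4 (-1) 1 mpowr 4" and ?C = "sym2 4 0 2 mpowr 4"
  have pos: "pos_def ?A" "pos_def ?B" "pos_def ?C"
    by (simp_all add: pos_def_mpowr pos_def_sym2)
  have AB: "d_p (1/2) ?A ?B = sqrt 136"
    and AC: "d_p (1/2) ?A ?C = sqrt (63/2)"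
    and CB: "d_p (1/2) ?C ?B = sqrt (63/2)"
    by (simp_all add: d_half_sym2)
  have "sqrt (63/2) + sqrt (63/2) = sqrt (4 * (63/2))"
    unfolding real_sqrt_mult by simp
  also have "\<dots> < sqrt 136" by simp
  finally have "d_p (1/2) ?A ?B > d_p (1/2) ?A ?C + d_p (1/2) ?C ?B"
    unfolding AB AC CB .
  with pos show ?thesis by blast
qed

end
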